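(* The set $I_{XTD^+} = \{e : \mathrm{XTD}^+(\mathcal L_e) < \infty\}$ is $\Pi^0_2$-complete.
   Context: $W_0,W_1,\ldots$ is an acceptable numbering of all r.e. subsets of $\mathbb N$; $L^e_j = \{x : \langle j,x\rangle \in W_e\}$ and $\mathcal L_e = \{L^e_j : j\in\mathbb N\}$. For a family $\mathcal L$ of subsets of $\mathbb N$ and a set $L\subseteq\mathbb N$, a set $S\subseteq L$ is a positive specifying set for $L$ w.r.t. $\mathcal L$ iff at most one member of $\mathcal L$ contains $S$. $\mathrm{XTD}^+(\mathcal L) = \inf\{d : \text{every nonempty } L\subseteq\mathbb N \text{ has a positive specifying set w.r.t. } \mathcal L \text{ with at most } d \text{ elements}\}$; if some nonempty $L$ has no positive specifying set, $\mathrm{XTD}^+(\mathcal L)=\infty$. $\Pi^0_n$-complete means definable by a $\Pi^0_n$ formula and every $\Pi^0_n$ set many-one reduces to it via a recursive function. *)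

theory Defs
  imports "HOL-Library.Nat_Bijection" "HOL-Library.Extended_Nat"
begin

(* recursive_fun n f: f is a (total) recursive function of n arguments. Arguments are
   passed as a list, and the values of f on lists of other lengths are irrelevant
   (rule ext). Minimisation is applied only to regular functions, i.e. those for which
   a zero always exists, so no partial functions occur; the functions obtained are
   exactly the total mu-recursive ones. *)
inductive recursive_fun :: "nat \<Rightarrow> (nat list \<Rightarrow> nat) \<Rightarrow> bool" where
  zero: "recursive_fun n (\<lambda>xs. 0)"
| succ: "recursive_fun 1 (\<lambda>xs. Suc (xs ! 0))"
| proj: "i < n \<Longrightarrow> recursive_fun n (\<lambda>xs. xs ! i)"
| comp: "recursive_fun (length gs) f \<Longrightarrow> (\<And>g. g \<in> set gs \<Longrightarrow> recursive_fun n g) \<Longrightarrow>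
    recursive_fun n (\<lambda>xs. f (map (\<lambda>g. g xs) gs))"
| prec: "recursive_fun n f \<Longrightarrow> recursive_fun (n + 2) g \<Longrightarrow>
    recursive_fun (n + 1) (\<lambda>xs. rec_nat (f (tl xs)) (\<lambda>k r. g (k # r # tl xs)) (hd xs))"
| mu: "recursive_fun (n + 1) f \<Longrightarrow> (\<And>xs. length xs = n \<Longrightarrow> \<exists>y. f (y # xs) = 0) \<Longrightarrow>
    recursive_fun n (\<lambda>xs. LEAST y. f (y # xs) = 0)"
| ext: "recursive_fun n f \<Longrightarrow> (\<And>xs. length xs = n \<Longrightarrow> f xs = g xs) \<Longrightarrow> recursive_fun n g"

definition recursive :: "(nat \<Rightarrow> nat) \<Rightarrow> bool" where
  "recursive f \<longleftrightarrow> recursive_fun 1 (\<lambda>xs. f (xs ! 0))"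

definition recursive_rel :: "nat \<Rightarrow> (nat list \<Rightarrow> bool) \<Rightarrow> bool" where
  "recursive_rel n R \<longleftrightarrow> recursive_fun n (\<lambda>xs. if R xs then 1 else 0)"

definition re_set :: "nat set \<Rightarrow> bool" where
  "re_set A \<longleftrightarrow> A = {} \<or> (\<exists>f. recursive f \<and> A = range f)"

definition uniformly_re :: "(nat \<Rightarrow> nat set) \<Rightarrow> bool" where
  "uniformly_re V \<longleftrightarrow> re_set {prod_encode (e, x) | e x. x \<in> V e}"

definition acceptable_numbering :: "(nat \<Rightarrow> nat set) \<Rightarrow> bool" where
  "acceptable_numbering W \<longleftrightarrow>
     range W = {A. re_set A} \<and> uniformly_re W \<and>
     (\<forall>V. uniformly_re V \<longrightarrow> (\<exists>f. recursive f \<and> (\<forall>e. V e = W (f e))))"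

(* sigma_form n R xs and pi_form n R xs are the formulas with n alternating quantifiers,
   starting with an existential, respectively universal, one, in front of R;
   xs lists the parameters followed by the variables quantified further outside. *)
fun sigma_form :: "nat \<Rightarrow> (nat list \<Rightarrow> bool) \<Rightarrow> nat list \<Rightarrow> bool"
  and pi_form :: "nat \<Rightarrow> (nat list \<Rightarrow> bool) \<Rightarrow> nat list \<Rightarrow> bool" where
  "sigma_form 0 R xs = R xs"
| "sigma_form (Suc n) R xs = (\<exists>y. pi_form n R (xs @ [y]))"
| "pi_form 0 R xs = R xs"
| "pi_form (Suc n) R xs = (\<forall>y. sigma_form n R (xs @ [y]))"

definition Pi0 :: "nat \<Rightarrow> nat set \<Rightarrow> bool" where
  "Pi0 n A \<longleftrightarrow> (\<exists>R. recursive_rel (n + 1) R \<and> A = {x. pi_form n R [x]})"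

definition many_one_reducible :: "nat set \<Rightarrow> nat set \<Rightarrow> bool" where
  "many_one_reducible A B \<longleftrightarrow> (\<exists>f. recursive f \<and> (\<forall>x. x \<in> A \<longleftrightarrow> f x \<in> B))"

definition Pi0_complete :: "nat \<Rightarrow> nat set \<Rightarrow> bool" where
  "Pi0_complete n A \<longleftrightarrow> Pi0 n A \<and> (\<forall>B. Pi0 n B \<longrightarrow> many_one_reducible B A)"

definition lang :: "(nat \<Rightarrow> nat set) \<Rightarrow> nat \<Rightarrow> nat \<Rightarrow> nat set" where
  "lang W e j = {x. prod_encode (j, x) \<in> W e}"

definition lang_family :: "(nat \<Rightarrow> nat set) \<Rightarrow> nat \<Rightarrow> nat set set" where
  "lang_family W e = {lang W e j | j. True}"

definition positive_specifying_set :: "nat set set \<Rightarrow> nat set \<Rightarrow> nat set \<Rightarrow> bool" where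
  "positive_specifying_set F L S \<longleftrightarrow> S \<subseteq> L \<and> (\<exists>\<^sub>\<le>\<^sub>1A. A \<in> F \<and> S \<subseteq> A)"

(* The infimum of the empty set in enat is \<infinity>. Both L and S range over arbitrary sets;
   L need not belong to F. *)
definition XTD_plus :: "nat set set \<Rightarrow> enat" where
  "XTD_plus F = Inf {enat d | d. \<forall>L. L \<noteq> {} \<longrightarrow>
     (\<exists>S. positive_specifying_set F L S \<and> finite S \<and> card S \<le> d)}"

end

theory Submission
  imports Defs
begin

text \<open>
  A singleton \<open>L = {x}\<close> has a positive specifying set only if at most one member of the family
  contains \<open>x\<close>. Hence the extended teaching dimension is finite exactly if distinct members are
  disjoint, and then it is at most 1. Disjointness of \<open>\<L>\<^sub>e\<close> says that for all \<open>i, j, x, y\<close>, if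
  \<open>x \<in> L\<^sub>i \<inter> L\<^sub>j\<close> and \<open>y \<in> L\<^sub>i\<close> then \<open>y \<in> L\<^sub>j\<close>, which is \<open>\<Pi>\<^sup>0\<^sub>2\<close>. For hardness, \<open>\<forall>y. \<exists>z. R(a, y, z)\<close> is
  reduced to the disjointness of the family consisting of \<open>\<nat>\<close> and
  \<open>{0} \<union> {y + 1 | \<exists>z. R(a, y, z)}\<close>: both contain 0, so disjointness means that they are equal.
\<close>

section \<open>Finite dimension and disjointness\<close>

lemma XTD_plus_finite_iff: "XTD_plus F < \<infinity> \<longleftrightarrow> pairwise disjnt F"
proof
  assume "XTD_plus F < \<infinity>"
  then obtain d where d: "\<And>L. L \<noteq> {} \<Longrightarrow> \<exists>S. positive_specifying_set F L S \<and> finite S \<and> card S \<le> d"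
    unfolding XTD_plus_def Inf_less_iff by blast
  have "A = B" if "A \<in> F" "B \<in> F" "x \<in> A" "x \<in> B" for A B x
  proof -
    \<comment> \<open>Whether \<open>S\<close> is empty or \<open>{x}\<close>, it lies in both
      \<open>A\<close> and \<open>B\<close>, so uniqueness forces them to be equal.\<close>
    obtain S where "S \<subseteq> {x}" "\<exists>\<^sub>\<le>\<^sub>1A. A \<in> F \<and> S \<subseteq> A"
      using d[of "{x}"] unfolding positive_specifying_set_def by auto
    then show ?thesis
      using that unfolding Uniq_def by blast
  qed
  then show "pairwise disjnt F"
    unfolding pairwise_def disjnt_def by blast
next
  assume disj: "pairwise disjnt F"
  have "\<exists>S. positive_specifying_set F L S \<and> finite S \<and> card S \<le> 1" if "L \<noteq> {}" for L
  proof -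
    from that obtain x where "x \<in> L" by blast
    then have "positive_specifying_set F L {x}"
      using disj unfolding positive_specifying_set_def pairwise_def disjnt_def Uniq_def by blast
    then show ?thesis
      by (intro exI[of _ "{x}"]) simp
  qed
  then have "XTD_plus F \<le> enat 1"
    unfolding XTD_plus_def by (intro Inf_lower) blast
  then show "XTD_plus F < \<infinity>"
    using enat_ord_simps(4) order_le_less_trans by blast
qed

subsection \<open>Closure properties of recursive functions\<close>

named_theorems rec_intros

lemmas [rec_intros] = recursive_fun.proj

lemma recursive_fun_comp1:
  assumes "recursive_fun 1 (\<lambda>xs. F (xs ! 0))" "recursive_fun n f"
  shows "recursive_fun n (\<lambda>xs. F (f xs))"
  using recursive_fun.comp[of "[f]" "\<lambda>xs. F (xs ! 0)" n] assms by simp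

lemma recursive_fun_comp2:
  assumes "recursive_fun 2 (\<lambda>xs. F (xs ! 0) (xs ! 1))" "recursive_fun n f" "recursive_fun n g"
  shows "recursive_fun n (\<lambda>xs. F (f xs) (g xs))"
  using recursive_fun.comp[of "[f, g]" "\<lambda>xs. F (xs ! 0) (xs ! 1)" n] assms
  by (auto simp: numeral_2_eq_2)

lemma recursive_fun_Suc [rec_intros]: "recursive_fun n f \<Longrightarrow> recursive_fun n (\<lambda>xs. Suc (f xs))"
  using recursive_fun_comp1[OF recursive_fun.succ] .

lemma recursive_fun_const [rec_intros]: "recursive_fun n (\<lambda>xs. c)"
  by (induction c) (auto intro: recursive_fun.zero recursive_fun_Suc)

text \<open>Lets a binary function be recognised as recursive from its two recursion equations
  alone, hiding the list form of \<open>rec_nat\<close>. The recursion runs on the first argument;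
  \<open>a\<close> is a parameter.\<close>

lemma recursive_fun_rec2:
  assumes b: "recursive_fun 1 (\<lambda>xs. b (xs ! 0))"
    and g: "recursive_fun 3 (\<lambda>xs. g (xs ! 0) (xs ! 1) (xs ! 2))"
    and F: "\<And>a. F 0 a = b a" "\<And>k a. F (Suc k) a = g k (F k a) a"
  shows "recursive_fun 2 (\<lambda>xs. F (xs ! 0) (xs ! 1))"
proof -
  have *: "recursive_fun (1 + 1) (\<lambda>xs. rec_nat (b (tl xs ! 0))
      (\<lambda>k r. g ((k # r # tl xs) ! 0) ((k # r # tl xs) ! 1) ((k # r # tl xs) ! 2)) (hd xs))"
    by (rule recursive_fun.prec[OF b]) (use g in \<open>simp add: numeral_3_eq_3\<close>)
  have F': "rec_nat (b a) (\<lambda>k r. g k r a) m = F m a" for m a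
    by (induction m) (auto simp: F)
  show ?thesis
  proof (rule recursive_fun.ext)
    show "recursive_fun 2 (\<lambda>xs. rec_nat (b (tl xs ! 0))
      (\<lambda>k r. g ((k # r # tl xs) ! 0) ((k # r # tl xs) ! 1) ((k # r # tl xs) ! 2)) (hd xs))"
      using * by (simp only: one_add_one)
  next
    fix xs :: "nat list" assume "length xs = 2"
    then obtain m a where "xs = [m, a]"
      by (auto simp: numeral_2_eq_2 length_Suc_conv)
    then show "rec_nat (b (tl xs ! 0))
      (\<lambda>k r. g ((k # r # tl xs) ! 0) ((k # r # tl xs) ! 1) ((k # r # tl xs) ! 2)) (hd xs)
      = F (xs ! 0) (xs ! 1)"
      by (simp add: F')
  qed
qed

lemma recursive_fun_mu:
  assumes "recursive_fun (Suc n) (\<lambda>xs. f (hd xs) (tl xs))"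
    and "\<And>xs. length xs = n \<Longrightarrow> \<exists>y. f y xs = 0"
  shows "recursive_fun n (\<lambda>xs. LEAST y. f y xs = 0)"
  using recursive_fun.mu[of n "\<lambda>xs. f (hd xs) (tl xs)"] assms by simp

lemma recursive_fun_add [rec_intros]:
  assumes "recursive_fun n f" "recursive_fun n g"
  shows "recursive_fun n (\<lambda>xs. f xs + g xs)"
proof (rule recursive_fun_comp2[OF _ assms])
  show "recursive_fun 2 (\<lambda>xs. xs ! 0 + xs ! 1)"
    by (rule recursive_fun_rec2[where b = "\<lambda>a. a" and g = "\<lambda>k r a. Suc r"])
      (auto intro!: rec_intros)
qed

lemma recursive_fun_mult [rec_intros]:
  assumes "recursive_fun n f" "recursive_fun n g"
  shows "recursive_fun n (\<lambda>xs. f xs * g xs)"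
proof (rule recursive_fun_comp2[OF _ assms])
  show "recursive_fun 2 (\<lambda>xs. xs ! 0 * xs ! 1)"
    by (rule recursive_fun_rec2[where b = "\<lambda>a. 0" and g = "\<lambda>k r a. a + r"])
      (auto intro!: rec_intros)
qed

lemma recursive_fun_pred:
  assumes "recursive_fun n f"
  shows "recursive_fun n (\<lambda>xs. f xs - 1)"
\<comment> \<open>The scheme \<open>recursive_fun_rec2\<close> expects a parameter, so
  \<open>a\<close> is a dummy and \<open>f\<close> is supplied for both arguments.\<close>
proof (rule recursive_fun_comp2[where F = "\<lambda>k a. k - 1", OF _ assms assms])
  show "recursive_fun 2 (\<lambda>xs. xs ! 0 - 1)"
    by (rule recursive_fun_rec2[where F = "\<lambda>k a. k - 1" and b = "\<lambda>a. 0" and g = "\<lambda>k r a. k"])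
      (auto intro!: rec_intros)
qed

lemma recursive_fun_diff [rec_intros]:
  assumes "recursive_fun n f" "recursive_fun n g"
  shows "recursive_fun n (\<lambda>xs. f xs - g xs)"
\<comment> \<open>The recursion is on the subtrahend, hence the swapped arguments; each step applies
  the predecessor.\<close>
proof (rule recursive_fun_comp2[OF _ assms(2,1)])
  show "recursive_fun 2 (\<lambda>xs. xs ! 1 - xs ! 0)"
    by (rule recursive_fun_rec2[where F = "\<lambda>k a. a - k" and b = "\<lambda>a. a" and g = "\<lambda>k r a. r - 1"])
      (auto intro!: rec_intros recursive_fun_pred simp del: One_nat_def)
qed

section \<open>Cantor pairing and its inverses\<close>

lemma recursive_fun_triangle [rec_intros]:
  assumes "recursive_fun n f"
  shows "recursive_fun n (\<lambda>xs. triangle (f xs))"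
proof (rule recursive_fun_comp2[where F = "\<lambda>k a. triangle k", OF _ assms assms])
  show "recursive_fun 2 (\<lambda>xs. triangle (xs ! 0))"
    by (rule recursive_fun_rec2[where F = "\<lambda>k a. triangle k" and b = "\<lambda>a. 0"
          and g = "\<lambda>k r a. r + Suc k"])
      (auto intro!: rec_intros)
qed

lemma recursive_fun_prod_encode [rec_intros]:
  "recursive_fun n f \<Longrightarrow> recursive_fun n g \<Longrightarrow> recursive_fun n (\<lambda>xs. prod_encode (f xs, g xs))"
  unfolding prod_encode_def by (auto intro!: rec_intros)

text \<open>Since \<open>z = triangle (a + b) + a\<close>, the sum \<open>a + b\<close> is the least
  \<open>w\<close> with \<open>z < triangle (Suc w)\<close>. With truncated subtraction this
  inequality is the vanishing of a recursive function, as minimisation requires.\<close>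

lemma prod_decode_sum_eq:
  "fst (prod_decode z) + snd (prod_decode z) = (LEAST w. Suc z - triangle (Suc w) = 0)"
proof -
  obtain a b where z: "z = prod_encode (a, b)"
    by (metis prod_decode_inverse surj_pair)
  have mono: "triangle m \<le> triangle n" if "m \<le> n" for m n
    unfolding triangle_def using that by (intro div_le_mono mult_le_mono) simp_all
  have "(LEAST w. Suc z - triangle (Suc w) = 0) = a + b"
  proof (rule Least_equality)
    show "Suc z - triangle (Suc (a + b)) = 0"
      by (simp add: z prod_encode_def)
  next
    fix w assume w: "Suc z - triangle (Suc w) = 0"
    show "a + b \<le> w"
    proof (rule ccontr)
      assume "\<not> a + b \<le> w"
      then have "triangle (Suc w) \<le> triangle (a + b)"
        by (intro mono) simp
      also have "\<dots> \<le> z"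
        by (simp add: z prod_encode_def)
      finally show False
        using w by linarith
    qed
  qed
  then show ?thesis
    by (simp add: z)
qed

text \<open>The first component recurs on the right only inside the sum, which minimisation computes
  separately, so the equation yields recursiveness.\<close>

lemma fst_prod_decode_eq:
  "fst (prod_decode z) = z - triangle (fst (prod_decode z) + snd (prod_decode z))"
proof -
  obtain a b where z: "z = prod_encode (a, b)"
    by (metis prod_decode_inverse surj_pair)
  then have "z = triangle (a + b) + a"
    by (simp add: prod_encode_def)
  moreover have "prod_decode z = (a, b)"
    by (simp add: z)
  ultimately show ?thesis
    by simp
qed

lemma recursive_fun_prod_decode_sum:
  assumes "recursive_fun n f"
  shows "recursive_fun n (\<lambda>xs. fst (prod_decode (f xs)) + snd (prod_decode (f xs)))"
proof (rule recursive_fun_comp1[OF _ assms])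
  let ?g = "\<lambda>y xs. Suc (xs ! 0) - triangle (Suc y)"
  show "recursive_fun 1 (\<lambda>xs. fst (prod_decode (xs ! 0)) + snd (prod_decode (xs ! 0)))"
    unfolding prod_decode_sum_eq
  proof (rule recursive_fun_mu)
    show "recursive_fun (Suc 1) (\<lambda>xs. ?g (hd xs) (tl xs))"
    proof (rule recursive_fun.ext)
      show "recursive_fun (Suc 1) (\<lambda>xs. Suc (xs ! 1) - triangle (Suc (xs ! 0)))"
        by (intro rec_intros) simp_all
    qed (auto simp: length_Suc_conv)
    show "\<exists>y. ?g y xs = 0" for xs :: "nat list"
      \<comment> \<open>Minimisation is regular because \<open>triangle (Suc z)\<close> is at least
        \<open>Suc z\<close>.\<close>
      by (rule exI[of _ "xs ! 0"]) simp
  qed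
qed

lemma recursive_fun_fst_prod_decode [rec_intros]:
  assumes "recursive_fun n f"
  shows "recursive_fun n (\<lambda>xs. fst (prod_decode (f xs)))"
  by (subst fst_prod_decode_eq) (intro rec_intros recursive_fun_prod_decode_sum assms)

lemma recursive_fun_snd_prod_decode [rec_intros]:
  assumes "recursive_fun n f"
  shows "recursive_fun n (\<lambda>xs. snd (prod_decode (f xs)))"
proof -
  have "recursive_fun n (\<lambda>xs. (fst (prod_decode (f xs)) + snd (prod_decode (f xs)))
      - fst (prod_decode (f xs)))"
    by (intro recursive_fun_diff rec_intros recursive_fun_prod_decode_sum assms)
  then show ?thesis
    by simp
qed

section \<open>Recursive relations and case distinctions\<close>

lemma recursive_rel_eq [rec_intros]:
  assumes "recursive_fun n f" "recursive_fun n g"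
  shows "recursive_rel n (\<lambda>xs. f xs = g xs)"
proof -
  \<comment> \<open>One of the two truncated differences is always 0, so their sum is the distance
    of the values.\<close>
  have "recursive_fun n (\<lambda>xs. 1 - ((f xs - g xs) + (g xs - f xs)))"
    by (intro rec_intros assms)
  moreover have "(\<lambda>xs. 1 - ((f xs - g xs) + (g xs - f xs))) = (\<lambda>xs. if f xs = g xs then 1 else 0)"
    by auto
  ultimately show ?thesis
    unfolding recursive_rel_def by simp
qed

lemma recursive_rel_not [rec_intros]:
  assumes "recursive_rel n P"
  shows "recursive_rel n (\<lambda>xs. \<not> P xs)"
proof -
  have "recursive_fun n (\<lambda>xs. 1 - (if P xs then 1 else 0))"
    using assms by (intro rec_intros) (simp add: recursive_rel_def)
  moreover have "(\<lambda>xs. 1 - (if P xs then 1 else 0)) = (\<lambda>xs. if \<not> P xs then 1 else 0 :: nat)"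
    by auto
  ultimately show ?thesis
    unfolding recursive_rel_def by simp
qed

lemma recursive_rel_conj [rec_intros]:
  assumes "recursive_rel n P" "recursive_rel n Q"
  shows "recursive_rel n (\<lambda>xs. P xs \<and> Q xs)"
proof -
  have "recursive_fun n (\<lambda>xs. (if P xs then 1 else 0) * (if Q xs then 1 else 0))"
    using assms by (intro rec_intros) (simp_all add: recursive_rel_def)
  moreover have "(\<lambda>xs. (if P xs then 1 else 0) * (if Q xs then 1 else 0))
      = (\<lambda>xs. if P xs \<and> Q xs then 1 else 0 :: nat)"
    by auto
  ultimately show ?thesis
    unfolding recursive_rel_def by simp
qed

lemma recursive_rel_disj [rec_intros]:
  assumes "recursive_rel n P" "recursive_rel n Q"
  shows "recursive_rel n (\<lambda>xs. P xs \<or> Q xs)"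
proof -
  have "recursive_rel n (\<lambda>xs. \<not> (\<not> P xs \<and> \<not> Q xs))"
    by (intro rec_intros assms)
  then show ?thesis
    by simp
qed

lemma recursive_rel_imp [rec_intros]:
  assumes "recursive_rel n P" "recursive_rel n Q"
  shows "recursive_rel n (\<lambda>xs. P xs \<longrightarrow> Q xs)"
  using recursive_rel_disj[OF recursive_rel_not[OF assms(1)] assms(2)] by simp

lemma recursive_fun_if [rec_intros]:
  assumes "recursive_rel n P" "recursive_fun n f" "recursive_fun n g"
  shows "recursive_fun n (\<lambda>xs. if P xs then f xs else g xs)"
proof -
  have "recursive_fun n (\<lambda>xs. (if P xs then 1 else 0) * f xs + (if \<not> P xs then 1 else 0) * g xs)"
    using assms recursive_rel_not[OF assms(1)]
    by (intro recursive_fun_add recursive_fun_mult) (simp_all only: recursive_rel_def)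
  moreover have "(\<lambda>xs. (if P xs then 1 else 0) * f xs + (if \<not> P xs then 1 else 0) * g xs)
      = (\<lambda>xs. if P xs then f xs else g xs)"
    by auto
  ultimately show ?thesis
    by simp
qed

lemma recursive_rel_comp3:
  assumes "recursive_rel 3 R" "recursive_fun n f" "recursive_fun n g" "recursive_fun n h"
  shows "recursive_rel n (\<lambda>xs. R [f xs, g xs, h xs])"
  using recursive_fun.comp[of "[f, g, h]" "\<lambda>xs. if R xs then 1 else 0" n] assms
  by (auto simp: recursive_rel_def numeral_3_eq_3)

text \<open>Surjectivity of pairing contracts two universal quantifiers to one; iterating this
  contracts a whole block.\<close>

lemma all_prod_decode_iff:
  "(\<forall>n. P (fst (prod_decode n)) (snd (prod_decode n))) \<longleftrightarrow> (\<forall>a b. P a b)"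
proof (intro iffI allI)
  fix a b assume "\<forall>n. P (fst (prod_decode n)) (snd (prod_decode n))"
  then show "P a b"
    by (auto dest: spec[of _ "prod_encode (a, b)"])
qed simp

lemma Pi0_2_iff:
  "Pi0 2 A \<longleftrightarrow> (\<exists>R. recursive_rel 3 R \<and> A = {x. \<forall>y. \<exists>z. R [x, y, z]})"
  by (simp add: Pi0_def numeral_2_eq_2 numeral_3_eq_3)

subsection \<open>The index set\<close>

text \<open>Different indices may name the same member, so disjointness means that rows sharing an
  element coincide. One inclusion suffices, as \<open>i\<close> and \<open>j\<close> can be
  exchanged.\<close>

lemma pairwise_disjnt_lang_family_iff:
  "pairwise disjnt (lang_family W e) \<longleftrightarrow>
    (\<forall>i j x y. x \<in> lang W e i \<and> x \<in> lang W e j \<and> y \<in> lang W e i \<longrightarrow> y \<in> lang W e j)"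
  unfolding pairwise_def disjnt_def lang_family_def by blast

lemma acceptable_numbering_enumeration:
  assumes "acceptable_numbering W"
  obtains f where "recursive f" "\<And>e x. x \<in> W e \<longleftrightarrow> (\<exists>s. f s = prod_encode (e, x))"
proof -
  let ?G = "{prod_encode (e, x) | e x. x \<in> W e}"
  have "recursive (\<lambda>x. x)"
    unfolding recursive_def by (intro rec_intros) simp
  then have "re_set UNIV"
    unfolding re_set_def by (metis surj_def)
  \<comment> \<open>Some \<open>W e\<close> is nonempty, which excludes the case of
    \<open>re_set\<close> without an enumerating function.\<close>
  then have "UNIV \<in> range W"
    using assms unfolding acceptable_numbering_def by simp
  then have "?G \<noteq> {}"
    by fastforce
  then obtain f where f: "recursive f" "?G = range f"
    using assms unfolding acceptable_numbering_def uniformly_re_def re_set_def by auto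
  have "x \<in> W e \<longleftrightarrow> prod_encode (e, x) \<in> ?G" for e x
    by auto
  then have "x \<in> W e \<longleftrightarrow> (\<exists>s. f s = prod_encode (e, x))" for e x
    unfolding f(2) by (metis rangeE rangeI)
  with f(1) show thesis
    using that by blast
qed

text \<open>The three memberships in the premise contribute stages \<open>s\<close>,
  \<open>t\<close>, \<open>u\<close> that become universal in prenex form; the membership in the
  conclusion contributes the only existential, \<open>v\<close>.\<close>

lemma Pi0_2_pairwise_disjnt_lang_family:
  assumes "acceptable_numbering W"
  shows "Pi0 2 {e. pairwise disjnt (lang_family W e)}"
proof -
  obtain f where f: "recursive f" and W: "\<And>e x. x \<in> W e \<longleftrightarrow> (\<exists>s. f s = prod_encode (e, x))"
    using acceptable_numbering_enumeration[OF assms] by blast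
  define Q where "Q e i j x y s t u v \<longleftrightarrow>
    f s = prod_encode (e, prod_encode (i, x)) \<and> f t = prod_encode (e, prod_encode (j, x)) \<and>
    f u = prod_encode (e, prod_encode (i, y)) \<longrightarrow> f v = prod_encode (e, prod_encode (j, y))"
    for e i j x y s t u v
  let ?p = "\<lambda>n. fst (prod_decode n)" and ?q = "\<lambda>n. snd (prod_decode n)"
  \<comment> \<open>The number \<open>n\<close> codes the right-nested tuple
    \<open>(i, j, x, y, s, t, u)\<close>.\<close>
  define R where "R xs \<longleftrightarrow> (let n = xs ! 1 in Q (xs ! 0) (?p n) (?p (?q n)) (?p (?q (?q n)))
    (?p (?q (?q (?q n)))) (?p (?q (?q (?q (?q n))))) (?p (?q (?q (?q (?q (?q n))))))
    (?q (?q (?q (?q (?q (?q n)))))) (xs ! 2))" for xs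
  have f_comp: "recursive_fun k (\<lambda>xs. f (g xs))" if "recursive_fun k g" for k g
    using recursive_fun_comp1 f that unfolding recursive_def by blast
  have "recursive_rel 3 R"
    unfolding R_def Q_def Let_def by (intro rec_intros f_comp) simp_all
  moreover have "pairwise disjnt (lang_family W e) \<longleftrightarrow> (\<forall>n. \<exists>v. R [e, n, v])" for e
  proof -
    have "pairwise disjnt (lang_family W e) \<longleftrightarrow> (\<forall>i j x y s t u. \<exists>v. Q e i j x y s t u v)"
      unfolding pairwise_disjnt_lang_family_iff lang_def mem_Collect_eq W Q_def by blast
    also have "\<dots> \<longleftrightarrow> (\<forall>n. \<exists>v. R [e, n, v])"
      by (simp add: R_def Let_def flip: all_prod_decode_iff)
    finally show ?thesis .
  qed
  ultimately show ?thesis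
    unfolding Pi0_2_iff by blast
qed

section \<open>Hardness\<close>

lemma Pi0_2_reducible_pairwise_disjnt_lang_family:
  assumes W: "acceptable_numbering W" and B: "Pi0 2 B"
  shows "many_one_reducible B {e. pairwise disjnt (lang_family W e)}"
proof -
  obtain R where R: "recursive_rel 3 R" "B = {a. \<forall>y. \<exists>z. R [a, y, z]}"
    using B unfolding Pi0_2_iff by blast
  let ?p = "\<lambda>n. fst (prod_decode n)" and ?q = "\<lambda>n. snd (prod_decode n)"
  \<comment> \<open>Only row 1 carries information, with 0 put in unconditionally and
    \<open>y\<close> shifted to \<open>y + 1\<close>; every other row is all of \<nat>, so at most
    two distinct members occur.\<close>
  define Q where "Q a j u z \<longleftrightarrow> j \<noteq> 1 \<or> u = 0 \<or> R [a, u - 1, z]" for a j u z :: nat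
  define V where "V a = {prod_encode (j, u) | j u. \<exists>z. Q a j u z}" for a
  have V_iff: "prod_encode (j, u) \<in> V a \<longleftrightarrow> (\<exists>z. Q a j u z)" for a j u
    unfolding V_def by auto
  \<comment> \<open>The fallback keeps the enumeration total: the pair \<open>(0, 0)\<close> always
    belongs to \<open>V a\<close>, since row 0 is full.\<close>
  define g where "g a j u z = (if Q a j u z then prod_encode (a, prod_encode (j, u))
    else prod_encode (a, prod_encode (0, 0)))" for a j u z
  define f where "f n = g (?p n) (?p (?q n)) (?p (?q (?q n))) (?q (?q (?q n)))" for n
  have "recursive f"
    unfolding recursive_def f_def g_def Q_def
    by (intro rec_intros recursive_rel_comp3[OF R(1)]) simp_all
  moreover have "{prod_encode (a, x) | a x. x \<in> V a} = range f"
  proof (intro equalityI subsetI)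
    fix w assume "w \<in> {prod_encode (a, x) | a x. x \<in> V a}"
    then obtain a j u z where "w = prod_encode (a, prod_encode (j, u))" "Q a j u z"
      unfolding V_def by blast
    then have "w = f (prod_encode (a, prod_encode (j, prod_encode (u, z))))"
      by (simp add: f_def g_def)
    then show "w \<in> range f"
      by simp
  next
    fix w assume "w \<in> range f"
    then obtain a j u z where w: "w = g a j u z"
      unfolding f_def by blast
    have "Q a 0 0 z"
      by (simp add: Q_def)
    then show "w \<in> {prod_encode (a, x) | a x. x \<in> V a}"
      unfolding w g_def using V_iff by auto
  qed
  ultimately have "uniformly_re V"
    unfolding uniformly_re_def re_set_def by blast
  \<comment> \<open>Acceptability translates indices of \<open>V\<close> into indices of
    \<open>W\<close>; this \<open>h\<close> is the reduction.\<close>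
  then obtain h where h: "recursive h" "\<And>a. V a = W (h a)"
    using W unfolding acceptable_numbering_def by blast
  have lang: "u \<in> lang W (h a) j \<longleftrightarrow> (\<exists>z. Q a j u z)" for a j u
    by (simp add: lang_def V_iff flip: h(2))
  have lang_other: "lang W (h a) j = UNIV" if "j \<noteq> 1" for a j
    using that by (auto simp: lang Q_def)
  have "pairwise disjnt (lang_family W (h a)) \<longleftrightarrow> lang W (h a) 1 = UNIV" for a
  proof
    assume disj: "pairwise disjnt (lang_family W (h a))"
    have "lang W (h a) 0 = UNIV" "0 \<in> lang W (h a) 1"
      by (simp_all add: lang lang_other Q_def)
    then have "u \<in> lang W (h a) 1" for u
      \<comment> \<open>The shared element is 0, and \<open>u\<close> is carried over from the full
        row 0 to row 1.\<close>
      using disj[unfolded pairwise_disjnt_lang_family_iff, rule_format, of 0 0 1 u] by simp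
    then show "lang W (h a) 1 = UNIV"
      by blast
  next
    assume "lang W (h a) 1 = UNIV"
    then have "lang W (h a) j = UNIV" for j
      using lang_other by (cases "j = 1") auto
    then show "pairwise disjnt (lang_family W (h a))"
      by (simp add: pairwise_disjnt_lang_family_iff)
  qed
  also have "lang W (h a) 1 = UNIV \<longleftrightarrow> (\<forall>y. \<exists>z. R [a, y, z])" for a
  proof -
    have "lang W (h a) 1 = UNIV \<longleftrightarrow> (\<forall>u. \<exists>z. Q a 1 u z)"
      using lang by blast
    \<comment> \<open>The case \<open>u = 0\<close> holds by the definition of \<open>Q\<close>,
      leaving successors only.\<close>
    also have "\<dots> \<longleftrightarrow> (\<forall>y. \<exists>z. Q a 1 (Suc y) z)"
      using Q_def by (metis not0_implies_Suc)
    also have "\<dots> \<longleftrightarrow> (\<forall>y. \<exists>z. R [a, y, z])"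
      by (simp add: Q_def)
    finally show ?thesis .
  qed
  finally show ?thesis
    using h(1) unfolding many_one_reducible_def R(2) by auto
qed

theorem theorem11:
  fixes W :: "nat \<Rightarrow> nat set"
  assumes "acceptable_numbering W"
  shows "Pi0_complete 2 {e. XTD_plus (lang_family W e) < \<infinity>}"
  using Pi0_2_pairwise_disjnt_lang_family[OF assms]
    Pi0_2_reducible_pairwise_disjnt_lang_family[OF assms]
  unfolding Pi0_complete_def XTD_plus_finite_iff by blast

end
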